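(* A finite set $\Sigma$ of Datalog$^\exists$ rules is both Warded Datalog$^\pm$ and Shy Datalog$^\exists$ if and only if it is Protected Datalog$^\pm$. That is, $\mathsf{warded}\cap\mathsf{shy}=\mathsf{protected}$.
   Context: A Datalog$^\exists$ rule is a formula $\forall \bar x\forall \bar y\,(\varphi(\bar x,\bar y)\to\exists \bar z\,\psi(\bar x,\bar z))$ with $\varphi$ (body) and $\psi$ (head) conjunctions of relational atoms whose terms are constants or variables; variables of $\bar z$ are $\exists$-variables, the others $\forall$-variables. A position $p[i]$ is the $i$-th argument of predicate $p$. Given a set $\Sigma$ of rules: $p[i]$ is affected if (i) some rule of $\Sigma$ has an $\exists$-variable at position $p[i]$ in its head, or (ii) some rule of $\Sigma$ has a $\forall$-variable occurring in its body only in affected positions and occurring at $p[i]$ in its head (least set closed under these). For an $\exists$-variable $y$ of $\Sigma$, $p[i]$ is invaded by $y$ if there is a rule $\rho\in\Sigma$ with head atom $p(t_1,\dots,t_k)$ such that either $t_i=y$, or $t_i$ is a $\forall$-variable occurring in the body of $\rho$ only in positions invaded by $y$ (least set closed under these); invaded positions are affected. A variable $x$ of a conjunction of atoms is attacked by $y$ in that conjunction if $x$ occurs in it only in positions invaded by $y$; $x$ is protected if it is attacked by no variable. $\mathsf{shy}$ (Shy Datalog$^\exists$) is the class of $\Sigma$ such that for every rule $\sigma\in\Sigma$: (S1) every variable occurring in more than one body atom of $\sigma$ is protected in the body of $\sigma$; (S2) if two distinct $\forall$-variables are not protected in the body of $\sigma$ but both occur in the head of $\sigma$ and in two different body atoms,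 then they are not attacked by the same variable. A $\forall$-variable $x$ of a rule $\rho$ is harmful (w.r.t. $\rho$) if it appears in $\rho$'s body only in affected positions, otherwise harmless; a harmful variable occurring in the head is dangerous. $\mathsf{warded}$ (Warded Datalog$^\pm$) is the class of $\Sigma$ such that for every rule $\sigma\in\Sigma$: (W1) all dangerous variables of $\sigma$ appear in a single body atom, called the ward; (W2) the ward shares only harmless variables with the other body atoms. A harmful $\forall$-variable of a rule $\rho$ is attacked harmful if all the (affected) body positions in which it occurs are invaded by one and the same $\exists$-variable, and protected harmful otherwise. A rule contains an attacked harmful join if some attacked harmful variable occurs in more than one of its body atoms. $\mathsf{protected}$ (Protected Datalog$^\pm$) is the class of $\Sigma$ such that every rule $\sigma\in\Sigma$ (P1) contains no attacked harmful join, and (P2) satisfies (W1) and (W2). *)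

theory Defs
  imports "HOL-Library.FSet"
begin

datatype ('c, 'v) trm = Const 'c | Var 'v

datatype ('p, 'c, 'v) atom = Atom (pred: 'p) (args: "('c, 'v) trm list")

text \<open>Conjunctions are finite sets of atoms. The quantifier prefix of a rule is determined by its
  body and head: the \<open>\<forall>\<close>-variables are those of the body, the \<open>\<exists>\<close>-variables are those that occur
  in the head only.\<close>

datatype ('p, 'c, 'v) rule =
  Rule (body: "('p, 'c, 'v) atom fset") (head: "('p, 'c, 'v) atom fset")

definition atom_vars :: "('p, 'c, 'v) atom \<Rightarrow> 'v set" where
  "atom_vars a = {x. Var x \<in> set (args a)}"

definition conj_vars :: "('p, 'c, 'v) atom fset \<Rightarrow> 'v set" where
  "conj_vars C = {x. \<exists>a. a |\<in>| C \<and> x \<in> atom_vars a}"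

definition forall_vars :: "('p, 'c, 'v) rule \<Rightarrow> 'v set" where
  "forall_vars \<rho> = conj_vars (body \<rho>)"

definition exists_vars :: "('p, 'c, 'v) rule \<Rightarrow> 'v set" where
  "exists_vars \<rho> = conj_vars (head \<rho>) - conj_vars (body \<rho>)"

definition datalog_program :: "('p \<Rightarrow> nat) \<Rightarrow> ('p, 'c, 'v) rule set \<Rightarrow> bool" where
  "datalog_program ar \<Sigma> \<longleftrightarrow> finite \<Sigma> \<and>
    (\<forall>\<rho>\<in>\<Sigma>. \<forall>a. a |\<in>| body \<rho> \<or> a |\<in>| head \<rho> \<longrightarrow> length (args a) = ar (pred a))"

text \<open>The pair \<open>(p, i)\<close> is the position \<open>p[i + 1]\<close>: arguments are counted from 0.\<close>

type_synonym 'p position = "'p \<times> nat"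

definition positions :: "'v \<Rightarrow> ('p, 'c, 'v) atom fset \<Rightarrow> 'p position set" where
  "positions x C =
    {(p, i). \<exists>a. a |\<in>| C \<and> pred a = p \<and> i < length (args a) \<and> args a ! i = Var x}"

inductive_set affected :: "('p, 'c, 'v) rule set \<Rightarrow> 'p position set"
  for \<Sigma> :: "('p, 'c, 'v) rule set" where
  affected_exists:
    "\<lbrakk>\<rho> \<in> \<Sigma>; z \<in> exists_vars \<rho>; q \<in> positions z (head \<rho>)\<rbrakk> \<Longrightarrow> q \<in> affected \<Sigma>"
| affected_forall:
    "\<lbrakk>\<rho> \<in> \<Sigma>; x \<in> forall_vars \<rho>; \<And>r. r \<in> positions x (body \<rho>) \<Longrightarrow> r \<in> affected \<Sigma>;
      q \<in> positions x (head \<rho>)\<rbrakk> \<Longrightarrow> q \<in> affected \<Sigma>"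

text \<open>An \<open>\<exists>\<close>-variable of \<open>\<Sigma>\<close> is a variable together with the rule that quantifies it. This keeps
  equally named variables of different rules apart, which replaces the usual convention that
  distinct rules share no variables.\<close>

type_synonym ('p, 'c, 'v) exvar = "('p, 'c, 'v) rule \<times> 'v"

definition program_exvars :: "('p, 'c, 'v) rule set \<Rightarrow> ('p, 'c, 'v) exvar set" where
  "program_exvars \<Sigma> = {(\<rho>, y). \<rho> \<in> \<Sigma> \<and> y \<in> exists_vars \<rho>}"

inductive_set invaded :: "('p, 'c, 'v) rule set \<Rightarrow> ('p, 'c, 'v) exvar \<Rightarrow> 'p position set"
  for \<Sigma> :: "('p, 'c, 'v) rule set" and e :: "('p, 'c, 'v) exvar" where
  invaded_exists:
    "\<lbrakk>\<rho> \<in> \<Sigma>; y \<in> exists_vars \<rho>; e = (\<rho>, y); q \<in> positions y (head \<rho>)\<rbrakk> \<Longrightarrow> q \<in> invaded \<Sigma> e"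
| invaded_forall:
    "\<lbrakk>\<rho> \<in> \<Sigma>; x \<in> forall_vars \<rho>; \<And>r. r \<in> positions x (body \<rho>) \<Longrightarrow> r \<in> invaded \<Sigma> e;
      q \<in> positions x (head \<rho>)\<rbrakk> \<Longrightarrow> q \<in> invaded \<Sigma> e"

definition attacked_in ::
  "('p, 'c, 'v) rule set \<Rightarrow> ('p, 'c, 'v) atom fset \<Rightarrow> 'v \<Rightarrow> ('p, 'c, 'v) exvar \<Rightarrow> bool" where
  "attacked_in \<Sigma> C x e \<longleftrightarrow>
    e \<in> program_exvars \<Sigma> \<and> x \<in> conj_vars C \<and> positions x C \<subseteq> invaded \<Sigma> e"

definition protected_in ::
  "('p, 'c, 'v) rule set \<Rightarrow> ('p, 'c, 'v) atom fset \<Rightarrow> 'v \<Rightarrow> bool" where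
  "protected_in \<Sigma> C x \<longleftrightarrow> x \<in> conj_vars C \<and> (\<nexists>e. attacked_in \<Sigma> C x e)"

definition occurs_in_several :: "'v \<Rightarrow> ('p, 'c, 'v) atom fset \<Rightarrow> bool" where
  "occurs_in_several x C \<longleftrightarrow>
    (\<exists>a b. a |\<in>| C \<and> b |\<in>| C \<and> a \<noteq> b \<and> x \<in> atom_vars a \<and> x \<in> atom_vars b)"

definition shy_joins :: "('p, 'c, 'v) rule set \<Rightarrow> ('p, 'c, 'v) rule \<Rightarrow> bool" where
  "shy_joins \<Sigma> \<sigma> \<longleftrightarrow> (\<forall>x. occurs_in_several x (body \<sigma>) \<longrightarrow> protected_in \<Sigma> (body \<sigma>) x)"

definition shy_head_vars :: "('p, 'c, 'v) rule set \<Rightarrow> ('p, 'c, 'v) rule \<Rightarrow> bool" where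
  "shy_head_vars \<Sigma> \<sigma> \<longleftrightarrow>
    (\<forall>x x' a a'. x \<in> forall_vars \<sigma> \<and> x' \<in> forall_vars \<sigma> \<and> x \<noteq> x' \<and>
      \<not> protected_in \<Sigma> (body \<sigma>) x \<and> \<not> protected_in \<Sigma> (body \<sigma>) x' \<and>
      x \<in> conj_vars (head \<sigma>) \<and> x' \<in> conj_vars (head \<sigma>) \<and>
      a |\<in>| body \<sigma> \<and> a' |\<in>| body \<sigma> \<and> a \<noteq> a' \<and> x \<in> atom_vars a \<and> x' \<in> atom_vars a' \<longrightarrow>
      (\<nexists>e. attacked_in \<Sigma> (body \<sigma>) x e \<and> attacked_in \<Sigma> (body \<sigma>) x' e))"

definition shy :: "('p \<Rightarrow> nat) \<Rightarrow> ('p, 'c, 'v) rule set set" where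
  "shy ar = {\<Sigma>. datalog_program ar \<Sigma> \<and> (\<forall>\<sigma>\<in>\<Sigma>. shy_joins \<Sigma> \<sigma> \<and> shy_head_vars \<Sigma> \<sigma>)}"

definition harmful :: "('p, 'c, 'v) rule set \<Rightarrow> ('p, 'c, 'v) rule \<Rightarrow> 'v \<Rightarrow> bool" where
  "harmful \<Sigma> \<rho> x \<longleftrightarrow> x \<in> forall_vars \<rho> \<and> positions x (body \<rho>) \<subseteq> affected \<Sigma>"

definition harmless :: "('p, 'c, 'v) rule set \<Rightarrow> ('p, 'c, 'v) rule \<Rightarrow> 'v \<Rightarrow> bool" where
  "harmless \<Sigma> \<rho> x \<longleftrightarrow> x \<in> forall_vars \<rho> \<and> \<not> harmful \<Sigma> \<rho> x"

definition dangerous :: "('p, 'c, 'v) rule set \<Rightarrow> ('p, 'c, 'v) rule \<Rightarrow> 'v \<Rightarrow> bool" where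
  "dangerous \<Sigma> \<rho> x \<longleftrightarrow> harmful \<Sigma> \<rho> x \<and> x \<in> conj_vars (head \<rho>)"

definition is_ward ::
  "('p, 'c, 'v) rule set \<Rightarrow> ('p, 'c, 'v) rule \<Rightarrow> ('p, 'c, 'v) atom \<Rightarrow> bool" where
  "is_ward \<Sigma> \<sigma> w \<longleftrightarrow> w |\<in>| body \<sigma> \<and>
    (\<forall>x. dangerous \<Sigma> \<sigma> x \<longrightarrow> x \<in> atom_vars w) \<and>
    (\<forall>b x. b |\<in>| body \<sigma> \<and> b \<noteq> w \<and> x \<in> atom_vars w \<and> x \<in> atom_vars b \<longrightarrow> harmless \<Sigma> \<sigma> x)"

text \<open>A rule without dangerous variables needs no ward.\<close>

definition warded_rule :: "('p, 'c, 'v) rule set \<Rightarrow> ('p, 'c, 'v) rule \<Rightarrow> bool" where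
  "warded_rule \<Sigma> \<sigma> \<longleftrightarrow> ((\<exists>x. dangerous \<Sigma> \<sigma> x) \<longrightarrow> (\<exists>w. is_ward \<Sigma> \<sigma> w))"

definition warded :: "('p \<Rightarrow> nat) \<Rightarrow> ('p, 'c, 'v) rule set set" where
  "warded ar = {\<Sigma>. datalog_program ar \<Sigma> \<and> (\<forall>\<sigma>\<in>\<Sigma>. warded_rule \<Sigma> \<sigma>)}"

definition attacked_harmful :: "('p, 'c, 'v) rule set \<Rightarrow> ('p, 'c, 'v) rule \<Rightarrow> 'v \<Rightarrow> bool" where
  "attacked_harmful \<Sigma> \<rho> x \<longleftrightarrow>
    harmful \<Sigma> \<rho> x \<and> (\<exists>e\<in>program_exvars \<Sigma>. positions x (body \<rho>) \<subseteq> invaded \<Sigma> e)"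

definition attacked_harmful_join :: "('p, 'c, 'v) rule set \<Rightarrow> ('p, 'c, 'v) rule \<Rightarrow> bool" where
  "attacked_harmful_join \<Sigma> \<rho> \<longleftrightarrow>
    (\<exists>x. attacked_harmful \<Sigma> \<rho> x \<and> occurs_in_several x (body \<rho>))"

definition protected :: "('p \<Rightarrow> nat) \<Rightarrow> ('p, 'c, 'v) rule set set" where
  "protected ar = {\<Sigma>. datalog_program ar \<Sigma> \<and>
    (\<forall>\<sigma>\<in>\<Sigma>. \<not> attacked_harmful_join \<Sigma> \<sigma> \<and> warded_rule \<Sigma> \<sigma>)}"

end

theory Submission
  imports Defs
begin

text \<open>Invaded positions are affected, so a variable attacked in a body is harmful. Hence (S1) says
  exactly that the rule contains no attacked harmful join. Wardedness alone implies (S2): two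
  attacked head variables are dangerous, so both occur in the ward; if they also occur in two
  different body atoms, one of these is not the ward and shares a harmful variable with it.\<close>

text \<open>Each introduction rule of \<open>invaded\<close> is the matching rule of
  \<open>affected\<close> with the existential variable fixed to \<open>e\<close>, so induction
  carries over rule by rule.\<close>

lemma invaded_subset_affected: "invaded \<Sigma> e \<subseteq> affected \<Sigma>"
proof
  fix q
  assume "q \<in> invaded \<Sigma> e"
  then show "q \<in> affected \<Sigma>"
    by induction (auto intro: affected.intros)
qed

lemma attacked_in_body_imp_harmful: "attacked_in \<Sigma> (body \<sigma>) x e \<Longrightarrow> harmful \<Sigma> \<sigma> x"
  using invaded_subset_affected[of \<Sigma> e]
  by (auto simp: attacked_in_def harmful_def forall_vars_def)

lemma attacked_harmful_iff_attacked_in_body: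
  "attacked_harmful \<Sigma> \<sigma> x \<longleftrightarrow> (\<exists>e. attacked_in \<Sigma> (body \<sigma>) x e)"
  using attacked_in_body_imp_harmful[of \<Sigma> \<sigma> x]
  by (auto simp: attacked_harmful_def attacked_in_def harmful_def forall_vars_def)

lemma shy_joins_iff_no_attacked_harmful_join:
  "shy_joins \<Sigma> \<sigma> \<longleftrightarrow> \<not> attacked_harmful_join \<Sigma> \<sigma>"
proof -
  \<comment> \<open>\<open>protected_in\<close> also demands that the variable occur in the
    conjunction; a join variable does, so for it protected means attacked by nothing.\<close>
  have "x \<in> conj_vars (body \<sigma>)" if "occurs_in_several x (body \<sigma>)" for x
    using that by (auto simp: occurs_in_several_def conj_vars_def)
  then show ?thesis
    by (auto simp: shy_joins_def attacked_harmful_join_def protected_in_def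
        attacked_harmful_iff_attacked_in_body)
qed

lemma warded_rule_imp_shy_head_vars:
  assumes "warded_rule \<Sigma> \<sigma>"
  shows "shy_head_vars \<Sigma> \<sigma>"
  unfolding shy_head_vars_def
proof (intro allI impI notI, elim conjE exE)
  fix x x' a a' e
  assume head: "x \<in> conj_vars (head \<sigma>)" "x' \<in> conj_vars (head \<sigma>)"
    and atoms: "a |\<in>| body \<sigma>" "a' |\<in>| body \<sigma>" "a \<noteq> a'" "x \<in> atom_vars a" "x' \<in> atom_vars a'"
    and attacked: "attacked_in \<Sigma> (body \<sigma>) x e" "attacked_in \<Sigma> (body \<sigma>) x' e"
  have dangerous: "dangerous \<Sigma> \<sigma> x" "dangerous \<Sigma> \<sigma> x'"
    using attacked head by (auto simp: dangerous_def dest: attacked_in_body_imp_harmful)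
  then obtain w where w: "is_ward \<Sigma> \<sigma> w"
    using assms by (auto simp: warded_rule_def)
  \<comment> \<open>A dangerous variable is harmful and lies in \<open>w\<close>, while
    \<open>w\<close> shares only harmless variables with the other body atoms.\<close>
  have only_ward: "b = w"
    if "dangerous \<Sigma> \<sigma> y" "b |\<in>| body \<sigma>" "y \<in> atom_vars b" for b y
    using w that by (auto simp: is_ward_def dangerous_def harmless_def)
  \<comment> \<open>Both \<open>a\<close> and \<open>a'\<close> equal \<open>w\<close>, although
    they are distinct.\<close>
  show False
    using only_ward dangerous atoms by blast
qed

theorem theorem1:
  fixes ar :: "'p \<Rightarrow> nat"
  shows "(\<forall>\<Sigma> :: ('p, 'c, 'v) rule set. datalog_program ar \<Sigma> \<longrightarrow>
            (\<Sigma> \<in> warded ar \<and> \<Sigma> \<in> shy ar \<longleftrightarrow> \<Sigma> \<in> protected ar)) \<and>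
         (warded ar \<inter> shy ar :: ('p, 'c, 'v) rule set set) = protected ar"
  by (auto simp: warded_def shy_def protected_def shy_joins_iff_no_attacked_harmful_join
      intro: warded_rule_imp_shy_head_vars)

end
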